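(* Let $(u^*,v^* )\in\mathbb{R}^n\times\mathbb{R}^n$ be an optimal solution of problem $(\mathrm{MAX}uv)$ and let $\rho^*\in\mathbb{R}^n$ be an optimal solution of problem $(\mathrm{MAX}\rho)$. Then $v(\overline{\mathrm{P}}(u^*,v^* )) = v(\overline{\mathrm{PR}}(\rho^* ))$.
   Context: Data and standing assumptions: $Q$ is a symmetric positive semidefinite $n\times n$ real matrix, $c,h\in\mathbb{R}^n$, $d\in\mathbb{R}^m$, $A,B\in\mathbb{R}^{m\times n}$, and $a,b\in\mathbb{R}^n$ with $a_i<b_i$ for all $i=1,\dots,n$. The mixed-integer problem $(\mathrm{P})$: minimize $f(x,y)=x^TQx+c^Tx+h^Ty$ subject to $Ax+By\le d$, $a_iy_i\le x_i\le b_iy_i$, $y_i\in\{0,1\}$ ($i=1,\dots,n$), is assumed to have a nonempty feasible set. $v(\cdot)$ denotes the optimal value of a problem; $\mathrm{diag}(r)$ is the diagonal matrix with diagonal $r$; $\succeq 0$ means positive semidefinite. Let $\overline{S}=\{(x,y)\in\mathbb{R}^n\times\mathbb{R}^n : Ax+By\le d,\ a_iy_i\le x_i\le b_iy_i,\ y_i\in[0,1],\ i=1,\dots,n\}$. For $u,v\in\mathbb{R}^n$, $f_{u,v}(x,y)=x^TQx+c^Tx+h^Ty+\sum_{i=1}^n(u_ix_iy_i+v_iy_i^2-u_ix_i-v_iy_i)$, and $(\overline{\mathrm{P}}(u,v))$ is the problem $\min\{f_{u,v}(x,y):(x,y)\in\overline{S}\}$. Problem $(\mathrm{MAX}uv)$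 is $\max\{v(\overline{\mathrm{P}}(u,v)) : u,v\in\mathbb{R}^n,\ f_{u,v} \text{ is convex on } \mathbb{R}^n\times\mathbb{R}^n\}$. For $\rho\in\mathbb{R}^n$, $f_\rho(x,y)=x^T(Q-\mathrm{diag}(\rho))x+c^Tx+h^Ty+\sum_{i=1}^n\rho_i\,x_i^2/y_i$ with the convention $0/0=0$ (if $y_i=0$ then $x_i=0$ on $\overline{S}$), and $(\overline{\mathrm{PR}}(\rho))$ is the problem $\min\{f_\rho(x,y):(x,y)\in\overline{S}\}$. Problem $(\mathrm{MAX}\rho)$ is $\max\{v(\overline{\mathrm{PR}}(\rho)) : \rho\ge0,\ Q-\mathrm{diag}(\rho)\succeq0\}$. *)

theory Defs
  imports "HOL-Analysis.Analysis"
begin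

definition diag :: "real ^ 'n \<Rightarrow> real ^ 'n ^ 'n" where
  "diag r = (\<chi> i j. if i = j then r $ i else 0)"

definition psd :: "real ^ 'n ^ 'n \<Rightarrow> bool" where
  "psd M \<longleftrightarrow> transpose M = M \<and> (\<forall>x. 0 \<le> x \<bullet> (M *v x))"

(* The infimum is taken in ereal, so that infeasible and unbounded problems
   get the values \<infinity> and -\<infinity> instead of an arbitrary real. *)
definition opt_value :: "('a \<Rightarrow> real) \<Rightarrow> 'a set \<Rightarrow> ereal" where
  "opt_value f S = (INF z\<in>S. ereal (f z))"

definition feasible_set ::
  "real ^ 'n ^ 'm \<Rightarrow> real ^ 'n ^ 'm \<Rightarrow> real ^ 'm \<Rightarrow> real ^ 'n \<Rightarrow> real ^ 'n
    \<Rightarrow> ((real ^ 'n) \<times> (real ^ 'n)) set" where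
  "feasible_set A B d a b = {(x, y). A *v x + B *v y \<le> d \<and>
     (\<forall>i. a $ i * y $ i \<le> x $ i \<and> x $ i \<le> b $ i * y $ i \<and> y $ i \<in> {0, 1})}"

definition relaxed_set ::
  "real ^ 'n ^ 'm \<Rightarrow> real ^ 'n ^ 'm \<Rightarrow> real ^ 'm \<Rightarrow> real ^ 'n \<Rightarrow> real ^ 'n
    \<Rightarrow> ((real ^ 'n) \<times> (real ^ 'n)) set" where
  "relaxed_set A B d a b = {(x, y). A *v x + B *v y \<le> d \<and>
     (\<forall>i. a $ i * y $ i \<le> x $ i \<and> x $ i \<le> b $ i * y $ i \<and> y $ i \<in> {0..1})}"

definition f_uv ::
  "real ^ 'n ^ 'n \<Rightarrow> real ^ 'n \<Rightarrow> real ^ 'n \<Rightarrow> real ^ 'n \<Rightarrow> real ^ 'n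
    \<Rightarrow> (real ^ 'n) \<times> (real ^ 'n) \<Rightarrow> real" where
  "f_uv Q c h u v = (\<lambda>(x, y). x \<bullet> (Q *v x) + c \<bullet> x + h \<bullet> y +
     (\<Sum>i\<in>UNIV. u $ i * x $ i * y $ i + v $ i * (y $ i)\<^sup>2 - u $ i * x $ i - v $ i * y $ i))"

(* On the relaxed set, y $ i = 0 forces x $ i = 0; the convention 0 / 0 = 0 for the
   perspective term is then HOL's own value of division by zero. *)
definition f_rho ::
  "real ^ 'n ^ 'n \<Rightarrow> real ^ 'n \<Rightarrow> real ^ 'n \<Rightarrow> real ^ 'n
    \<Rightarrow> (real ^ 'n) \<times> (real ^ 'n) \<Rightarrow> real" where
  "f_rho Q c h \<rho> = (\<lambda>(x, y). x \<bullet> ((Q - diag \<rho>) *v x) + c \<bullet> x + h \<bullet> y +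
     (\<Sum>i\<in>UNIV. \<rho> $ i * ((x $ i)\<^sup>2 / y $ i)))"

definition v_P ::
  "real ^ 'n ^ 'n \<Rightarrow> real ^ 'n \<Rightarrow> real ^ 'n \<Rightarrow> real ^ 'n ^ 'm \<Rightarrow> real ^ 'n ^ 'm \<Rightarrow> real ^ 'm
    \<Rightarrow> real ^ 'n \<Rightarrow> real ^ 'n \<Rightarrow> real ^ 'n \<Rightarrow> real ^ 'n \<Rightarrow> ereal" where
  "v_P Q c h A B d a b u v = opt_value (f_uv Q c h u v) (relaxed_set A B d a b)"

definition v_PR ::
  "real ^ 'n ^ 'n \<Rightarrow> real ^ 'n \<Rightarrow> real ^ 'n \<Rightarrow> real ^ 'n ^ 'm \<Rightarrow> real ^ 'n ^ 'm \<Rightarrow> real ^ 'm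
    \<Rightarrow> real ^ 'n \<Rightarrow> real ^ 'n \<Rightarrow> real ^ 'n \<Rightarrow> ereal" where
  "v_PR Q c h A B d a b \<rho> = opt_value (f_rho Q c h \<rho>) (relaxed_set A B d a b)"

definition optimal_MAXuv ::
  "real ^ 'n ^ 'n \<Rightarrow> real ^ 'n \<Rightarrow> real ^ 'n \<Rightarrow> real ^ 'n ^ 'm \<Rightarrow> real ^ 'n ^ 'm \<Rightarrow> real ^ 'm
    \<Rightarrow> real ^ 'n \<Rightarrow> real ^ 'n \<Rightarrow> real ^ 'n \<Rightarrow> real ^ 'n \<Rightarrow> bool" where
  "optimal_MAXuv Q c h A B d a b u v \<longleftrightarrow>
     is_arg_max (\<lambda>(u, v). v_P Q c h A B d a b u v)
       (\<lambda>(u, v). convex_on UNIV (f_uv Q c h u v)) (u, v)"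

definition optimal_MAXrho ::
  "real ^ 'n ^ 'n \<Rightarrow> real ^ 'n \<Rightarrow> real ^ 'n \<Rightarrow> real ^ 'n ^ 'm \<Rightarrow> real ^ 'n ^ 'm \<Rightarrow> real ^ 'm
    \<Rightarrow> real ^ 'n \<Rightarrow> real ^ 'n \<Rightarrow> real ^ 'n \<Rightarrow> bool" where
  "optimal_MAXrho Q c h A B d a b \<rho> \<longleftrightarrow>
     is_arg_max (v_PR Q c h A B d a b) (\<lambda>\<rho>. 0 \<le> \<rho> \<and> psd (Q - diag \<rho>)) \<rho>"

end

theory Submission
  imports Defs
begin

text \<open>
  The two relaxations are linked by an algebraic identity in each coordinate. If
  \<open>u = - 2 * \<rho> * t\<close> and \<open>v = \<rho> * t\<^sup>2\<close>, then
  \<open>\<rho> * x\<^sup>2 + u * x * y + v * y\<^sup>2 = \<rho> * (x - t * y)\<^sup>2\<close>, and the amount by which the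
  perspective term \<open>\<rho> * x\<^sup>2 / y\<close> exceeds what \<open>f_uv\<close> puts in its place is
  \<open>\<rho> * (1 - y) / y * (x - t * y)\<^sup>2 \<ge> 0\<close>.

  One inequality between the optimal values is a pointwise comparison. A convex \<open>f_uv\<close> has a
  positive semidefinite quadratic part; eliminating \<open>y\<close> from it (a Schur complement) shows that
  \<open>\<rho> = u\<^sup>2 / (4 * v)\<close> is feasible for the perspective problem, and then \<open>f_uv \<le> f_rho\<close>
  on the relaxed set (lemma \<open>convex_f_uv_le_f_rho\<close>).

  The other inequality is a minimax statement: the slopes \<open>t\<close> have to be chosen once for all
  points of the relaxed set. If a minimiser \<open>(p, q)\<close> of \<open>f_rho\<close> has \<open>q > 0\<close> in every
  coordinate, then \<open>t = p / q\<close> works. Indeed, replacing each \<open>x\<^sup>2 / y\<close> by its tangent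
  \<open>2 * t * x - t\<^sup>2 * y\<close> gives a convex function (\<open>tangent_minorant\<close>) with the same value and
  the same gradient as \<open>f_rho\<close> at \<open>(p, q)\<close>, hence with the same minimum, and \<open>f_uv\<close> lies above
  it. Coordinates with \<open>q = 0\<close> are kinks of \<open>f_rho\<close>, where no slope is singled out. They are
  handled by replacing \<open>y\<close> by \<open>y + e\<close> in the denominators
  (\<open>smoothed_min_tangent\<close>). As \<open>x / y\<close> is bounded on the relaxed set, this changes
  \<open>f_rho\<close> by at most a multiple of \<open>e\<close> (\<open>smoothed_f_rho_ge\<close>), and the slopes stay in a
  fixed box, so that a cluster point of them for \<open>e \<rightarrow> 0\<close> serves for \<open>f_rho\<close> itself
  (\<open>perspective_dual\<close>).
\<close>

section \<open>Quadratic forms and convexity\<close>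

lemma diag_quadratic_form: "x \<bullet> (diag r *v x) = (\<Sum>i\<in>UNIV. r $ i * (x $ i)\<^sup>2)"
proof -
  have "(diag r *v x) $ i = r $ i * x $ i" for i
    by (simp add: diag_def matrix_vector_mult_def if_distrib[of "\<lambda>z. z * _"] cong: if_cong)
  thus ?thesis
    by (simp add: inner_vec_def power2_eq_square mult.left_commute)
qed

lemma psd_diff_diag:
  assumes "psd Q" "\<And>x. 0 \<le> x \<bullet> (Q *v x) - (\<Sum>i\<in>UNIV. r $ i * (x $ i)\<^sup>2)"
  shows "psd (Q - diag r)"
proof -
  have "transpose (Q - diag r) = Q - diag r"
    using assms(1) by (auto simp: psd_def transpose_def diag_def vec_eq_iff)
  thus ?thesis
    using assms(2) by (simp add: psd_def matrix_vector_mult_diff_rdistrib inner_diff_right diag_quadratic_form)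
qed

text \<open>The homogeneous quadratic part of \<open>f_uv\<close>, whose sign decides convexity.\<close>

definition uv_form :: "real ^ 'n ^ 'n \<Rightarrow> real ^ 'n \<Rightarrow> real ^ 'n \<Rightarrow> real ^ 'n \<Rightarrow> real ^ 'n \<Rightarrow> real" where
  "uv_form Q u v x y = x \<bullet> (Q *v x) + (\<Sum>i\<in>UNIV. u $ i * x $ i * y $ i + v $ i * (y $ i)\<^sup>2)"

lemma f_uv_eq:
  "f_uv Q c h u v (x, y) = uv_form Q u v x y + ((c - u) \<bullet> x + (h - v) \<bullet> y)"
  by (simp add: f_uv_def uv_form_def sum_subtractf sum.distrib inner_diff_left)
     (simp add: inner_vec_def)

text \<open>
  For any quadratic form \<open>q\<close> the gap in Jensen's inequality between \<open>z\<close> and \<open>w\<close> is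
  \<open>k * (1 - k) * q (z - w)\<close>. This makes convexity the same as nonnegativity without derivatives.
\<close>

lemma uv_form_convexity_defect:
  "(1 - k) * uv_form Q u v x y + k * uv_form Q u v x' y'
     - uv_form Q u v ((1 - k) *\<^sub>R x + k *\<^sub>R x') ((1 - k) *\<^sub>R y + k *\<^sub>R y')
   = k * (1 - k) * uv_form Q u v (x - x') (y - y')"
proof -
  have Q: "(1 - k) * (x \<bullet> (Q *v x)) + k * (x' \<bullet> (Q *v x'))
      - ((1 - k) *\<^sub>R x + k *\<^sub>R x') \<bullet> (Q *v ((1 - k) *\<^sub>R x + k *\<^sub>R x'))
      = k * (1 - k) * ((x - x') \<bullet> (Q *v (x - x')))"
    by (simp add: matrix_vector_right_distrib matrix_vector_mult_diff_distrib
        matrix_vector_mult_scaleR inner_add_left inner_add_right inner_diff_left inner_diff_right)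
       algebra
  define g where "g x y i = u $ i * x $ i * y $ i + v $ i * (y $ i)\<^sup>2" for x y i
  have "(1 - k) * g x y i + k * g x' y' i
      - g ((1 - k) *\<^sub>R x + k *\<^sub>R x') ((1 - k) *\<^sub>R y + k *\<^sub>R y') i
      = k * (1 - k) * g (x - x') (y - y') i" for i
    unfolding g_def by simp algebra
  hence "(1 - k) * (\<Sum>i\<in>UNIV. g x y i) + k * (\<Sum>i\<in>UNIV. g x' y' i)
      - (\<Sum>i\<in>UNIV. g ((1 - k) *\<^sub>R x + k *\<^sub>R x') ((1 - k) *\<^sub>R y + k *\<^sub>R y') i)
      = k * (1 - k) * (\<Sum>i\<in>UNIV. g (x - x') (y - y') i)"
    by (simp add: sum_distrib_left flip: sum.distrib sum_subtractf)
  with Q show ?thesis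
    unfolding uv_form_def g_def[symmetric] by (simp add: algebra_simps)
qed

text \<open>
  Linear terms do not affect convexity. For necessity, midpoint convexity at \<open>0\<close> between a
  point and its negative makes them cancel.
\<close>

lemma convex_f_uv_iff:
  "convex_on UNIV (f_uv Q c h u v) \<longleftrightarrow> (\<forall>x y. 0 \<le> uv_form Q u v x y)"
proof
  assume conv: "convex_on UNIV (f_uv Q c h u v)"
  show "\<forall>x y. 0 \<le> uv_form Q u v x y"
  proof (intro allI)
    fix x y
    have "f_uv Q c h u v ((1 - 1/2) *\<^sub>R (x, y) + (1/2) *\<^sub>R (- x, - y))
        \<le> (1 - 1/2) * f_uv Q c h u v (x, y) + (1/2) * f_uv Q c h u v (- x, - y)"
      by (rule convex_onD[OF conv]) auto
    moreover have "Q *v (- x) = - (Q *v x)"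
      by (metis matrix_vector_mult_scaleR scaleR_minus1_left)
    ultimately show "0 \<le> uv_form Q u v x y"
      by (simp add: f_uv_eq) (simp add: uv_form_def field_simps)
  qed
next
  assume nonneg: "\<forall>x y. 0 \<le> uv_form Q u v x y"
  show "convex_on UNIV (f_uv Q c h u v)"
  proof (intro convex_onI)
    fix k :: real and z w :: "(real ^ 'a) \<times> (real ^ 'a)"
    assume k: "0 < k" "k < 1"
    obtain x y x' y' where zw: "z = (x, y)" "w = (x', y')" by fastforce
    have "0 \<le> k * (1 - k) * uv_form Q u v (x - x') (y - y')"
      using k nonneg by simp
    thus "f_uv Q c h u v ((1 - k) *\<^sub>R z + k *\<^sub>R w)
        \<le> (1 - k) * f_uv Q c h u v z + k * f_uv Q c h u v w"
      unfolding uv_form_convexity_defect[symmetric]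
      by (simp add: zw f_uv_eq inner_add_right algebra_simps)
  qed simp
qed

section \<open>Geometry of the relaxed set\<close>

text \<open>
  The ratios \<open>x / y\<close> are bounded by one constant on the whole relaxed set. This bounds the
  slopes of the tangents and makes the smoothing error uniform.
\<close>

lemma relaxed_set_abs_le:
  assumes "(x, y) \<in> relaxed_set A B d a b"
  shows "\<bar>x $ i\<bar> \<le> max \<bar>a $ i\<bar> \<bar>b $ i\<bar> * y $ i"
proof -
  from assms have *: "a $ i * y $ i \<le> x $ i" "x $ i \<le> b $ i * y $ i" "0 \<le> y $ i"
    by (auto simp: relaxed_set_def)
  have "- max \<bar>a $ i\<bar> \<bar>b $ i\<bar> * y $ i \<le> a $ i * y $ i" "b $ i * y $ i \<le> max \<bar>a $ i\<bar> \<bar>b $ i\<bar> * y $ i"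
    by (rule mult_right_mono; use * in linarith)+
  with * show ?thesis by linarith
qed

lemma convex_relaxed_set: "convex (relaxed_set A B d a b)"
  unfolding convex_def
proof (clarsimp simp: relaxed_set_def, intro conjI allI)
  fix x y x' y' :: "real ^ 'a" and k l :: real
  assume A: "A *v x + B *v y \<le> d" "A *v x' + B *v y' \<le> d"
    and k: "0 \<le> k" "0 \<le> l" "k + l = 1"
    and b: "\<forall>i. a $ i * y $ i \<le> x $ i \<and> x $ i \<le> b $ i * y $ i \<and> 0 \<le> y $ i \<and> y $ i \<le> 1"
    and b': "\<forall>i. a $ i * y' $ i \<le> x' $ i \<and> x' $ i \<le> b $ i * y' $ i \<and> 0 \<le> y' $ i \<and> y' $ i \<le> 1"
  have "k *\<^sub>R (A *v x + B *v y) + l *\<^sub>R (A *v x' + B *v y') \<le> k *\<^sub>R d + l *\<^sub>R d"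
    using A k by (intro add_mono scaleR_left_mono)
  also have "\<dots> = d" using k by (simp flip: scaleR_left_distrib)
  finally show "A *v (k *\<^sub>R x + l *\<^sub>R x') + B *v (k *\<^sub>R y + l *\<^sub>R y') \<le> d"
    by (simp add: matrix_vector_right_distrib matrix_vector_mult_scaleR algebra_simps)
  fix i
  have "k * (a $ i * y $ i) + l * (a $ i * y' $ i) \<le> k * x $ i + l * x' $ i"
    "k * x $ i + l * x' $ i \<le> k * (b $ i * y $ i) + l * (b $ i * y' $ i)"
    "k * y $ i + l * y' $ i \<le> k * 1 + l * 1"
    by (intro add_mono mult_left_mono; use k b b' in blast)+
  thus "a $ i * (k * y $ i + l * y' $ i) \<le> k * x $ i + l * x' $ i"
    "k * x $ i + l * x' $ i \<le> b $ i * (k * y $ i + l * y' $ i)"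
    by (simp_all add: algebra_simps)
  show "k * y $ i + l * y' $ i \<le> 1"
    using \<open>k * y $ i + l * y' $ i \<le> k * 1 + l * 1\<close> unfolding mult_1_right k(3) .
qed

lemma continuous_on_matrix_vector_mult:
  fixes A :: "real ^ 'n ^ 'm"
  assumes "continuous_on S f"
  shows "continuous_on S (\<lambda>z. A *v f z)"
  using continuous_on_compose2[OF matrix_vector_mult_linear_continuous_on assms] by blast

lemma compact_relaxed_set: "compact (relaxed_set A B d a b)"
proof -
  define T :: "real ^ 'a" where "T = (\<chi> i. max \<bar>a $ i\<bar> \<bar>b $ i\<bar>)"
  have "relaxed_set A B d a b \<subseteq> cbox (- T) T \<times> cbox 0 1"
  proof (clarify)
    fix x y assume xy: "(x, y) \<in> relaxed_set A B d a b"
    have y: "0 \<le> y $ i" "y $ i \<le> 1" for i using xy by (auto simp: relaxed_set_def)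
    have "\<bar>x $ i\<bar> \<le> T $ i" for i
    proof -
      have "\<bar>x $ i\<bar> \<le> T $ i * y $ i" using relaxed_set_abs_le[OF xy] by (simp add: T_def)
      also have "\<dots> \<le> T $ i * 1" using y by (intro mult_left_mono) (auto simp: T_def)
      finally show ?thesis by simp
    qed
    hence "- T $ i \<le> x $ i" "x $ i \<le> T $ i" for i by (simp_all add: abs_le_iff minus_le_iff)
    with y show "x \<in> cbox (- T) T \<and> y \<in> cbox 0 1" by (simp add: mem_box_cart)
  qed
  moreover have "closed (relaxed_set A B d a b)"
  proof -
    have eq: "relaxed_set A B d a b = {z. \<forall>j. (A *v fst z + B *v snd z) $ j \<le> d $ j}
      \<inter> {z. \<forall>i. a $ i * snd z $ i \<le> fst z $ i \<and> fst z $ i \<le> b $ i * snd z $ i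
             \<and> 0 \<le> snd z $ i \<and> snd z $ i \<le> 1}"
      by (auto simp: relaxed_set_def less_eq_vec_def)
    show ?thesis unfolding eq
      by (intro closed_Int closed_Collect_all closed_Collect_conj closed_Collect_le
          continuous_intros continuous_on_matrix_vector_mult)
  qed
  ultimately show ?thesis
    using compact_Times[OF compact_cbox compact_cbox] compact_Int_closed Int_absorb1 by metis
qed


section \<open>Convex quadratic relaxations are dominated by perspective relaxations\<close>

lemma f_rho_eq:
  "f_rho Q c h \<rho> (x, y) = f_uv (Q - diag \<rho>) c h 0 0 (x, y) + (\<Sum>i\<in>UNIV. \<rho> $ i * ((x $ i)\<^sup>2 / y $ i))"
  by (simp add: f_rho_def f_uv_def)

lemma f_uv_diff_diag:
  "f_uv (Q - diag \<rho>) c h 0 0 (x, y) = f_uv Q c h 0 0 (x, y) - (\<Sum>i\<in>UNIV. \<rho> $ i * (x $ i)\<^sup>2)"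
  by (simp add: f_uv_def matrix_vector_mult_diff_rdistrib inner_diff_right diag_quadratic_form)

lemma f_uv_split:
  "f_uv Q c h u v (x, y) = f_uv Q c h 0 0 (x, y)
     + (\<Sum>i\<in>UNIV. u $ i * x $ i * y $ i + v $ i * (y $ i)\<^sup>2 - u $ i * x $ i - v $ i * y $ i)"
  by (simp add: f_uv_def)

text \<open>
  Only the diagonal entry of \<open>Q\<close> and the coefficients \<open>u\<close>, \<open>v\<close> of one coordinate matter here:
  a nonnegative form in two variables has a nonnegative diagonal, and a zero diagonal
  entry forces the mixed term to vanish.
\<close>

lemma uv_form_nonneg_coeffs:
  assumes nonneg: "\<And>x y. 0 \<le> uv_form Q u v x y"
  shows "0 \<le> v $ i" and "v $ i = 0 \<Longrightarrow> u $ i = 0"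
proof -
  have axis_form: "uv_form Q u v (axis i p) (axis i r)
      = axis i p \<bullet> (Q *v axis i p) + (u $ i * p * r + v $ i * r\<^sup>2)" for p r
  proof -
    have "(\<Sum>j\<in>UNIV. u $ j * axis i p $ j * axis i r $ j + v $ j * (axis i r $ j)\<^sup>2)
        = (\<Sum>j\<in>UNIV. if j = i then u $ i * p * r + v $ i * r\<^sup>2 else 0)"
      by (intro sum.cong) (auto simp: axis_def)
    thus ?thesis by (simp add: uv_form_def)
  qed
  have "axis i 0 = (0 :: real ^ 'a)" by (simp add: axis_def vec_eq_iff)
  with nonneg[of "axis i 0" "axis i 1"] show "0 \<le> v $ i" unfolding axis_form by simp
  assume "v $ i = 0"
  define w where "w = axis i 1 \<bullet> (Q *v axis i 1)"
  show "u $ i = 0"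
  proof (rule ccontr)
    assume "u $ i \<noteq> 0"
    \<comment> \<open>The form is affine in the second variable; at this point it takes the value \<open>-1\<close>.\<close>
    with nonneg[of "axis i 1" "axis i (- (w + 1) / u $ i)"] \<open>v $ i = 0\<close> show False
      unfolding axis_form by (simp add: w_def)
  qed
qed

text \<open>
  The weight \<open>\<rho> = u\<^sup>2 / (4 * v)\<close> is the one for which
  \<open>\<rho> * x\<^sup>2 + u * x * y + v * y\<^sup>2\<close> is a perfect square, so \<open>- \<rho> * x\<^sup>2\<close> is the minimum of
  \<open>u * x * y + v * y\<^sup>2\<close> over \<open>y\<close>. Completing the square a second time, now in the difference of the
  objectives, gives the domination.
\<close>

lemma convex_f_uv_le_f_rho:
  assumes psd: "psd Q" and conv: "convex_on UNIV (f_uv Q c h u v)"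
  obtains \<rho> where "0 \<le> \<rho>" "psd (Q - diag \<rho>)"
    "\<And>z. z \<in> relaxed_set A B d a b \<Longrightarrow> f_uv Q c h u v z \<le> f_rho Q c h \<rho> z"
proof -
  have nonneg: "0 \<le> uv_form Q u v x y" for x y
    using conv by (simp add: convex_f_uv_iff)
  note v = uv_form_nonneg_coeffs[OF nonneg]
  \<comment> \<open>If \<open>v\<close> vanishes in a coordinate, so does \<open>u\<close>, and \<open>0 / 0 = 0\<close> is the right weight there.\<close>
  define \<rho> where "\<rho> = (\<chi> i. (u $ i)\<^sup>2 / (4 * v $ i))"
  have "0 \<le> \<rho>" using v(1) by (simp add: \<rho>_def less_eq_vec_def)
  moreover have "psd (Q - diag \<rho>)"
  proof (rule psd_diff_diag[OF psd])
    fix x :: "real ^ 'a"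
    \<comment> \<open>the minimiser of the form for given \<open>x\<close>\<close>
    define y where "y = (\<chi> i. - (u $ i * x $ i) / (2 * v $ i))"
    have "u $ i * x $ i * y $ i + v $ i * (y $ i)\<^sup>2 = - (\<rho> $ i * (x $ i)\<^sup>2)" for i
      using v[of i] by (cases "v $ i = 0") (auto simp: y_def \<rho>_def field_simps power2_eq_square)
    hence "uv_form Q u v x y = x \<bullet> (Q *v x) - (\<Sum>i\<in>UNIV. \<rho> $ i * (x $ i)\<^sup>2)"
      by (simp add: uv_form_def sum_negf)
    with nonneg[of x y] show "0 \<le> x \<bullet> (Q *v x) - (\<Sum>i\<in>UNIV. \<rho> $ i * (x $ i)\<^sup>2)" by simp
  qed
  moreover have "f_uv Q c h u v z \<le> f_rho Q c h \<rho> z" if "z \<in> relaxed_set A B d a b" for z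
  proof -
    obtain x y where z: "z = (x, y)" by fastforce
    have "u $ i * x $ i * y $ i + v $ i * (y $ i)\<^sup>2 - u $ i * x $ i - v $ i * y $ i
        \<le> \<rho> $ i * ((x $ i)\<^sup>2 / y $ i) - \<rho> $ i * (x $ i)\<^sup>2" for i
    proof (cases "y $ i = 0 \<or> v $ i = 0")
      case True
      moreover have "x $ i = 0" if "y $ i = 0"
        using relaxed_set_abs_le[of x y A B d a b i] that \<open>z \<in> _\<close> z by simp
      ultimately show ?thesis using v[of i] by (auto simp: \<rho>_def)
    next
      case False
      with v(1)[of i] \<open>z \<in> _\<close> have pos: "0 < v $ i" "0 < y $ i" "y $ i \<le> 1"
        by (auto simp: relaxed_set_def z less_le)
      have "\<rho> $ i * ((x $ i)\<^sup>2 / y $ i) - \<rho> $ i * (x $ i)\<^sup>2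
          - (u $ i * x $ i * y $ i + v $ i * (y $ i)\<^sup>2 - u $ i * x $ i - v $ i * y $ i)
          = (1 - y $ i) / (4 * v $ i * y $ i) * (u $ i * x $ i + 2 * v $ i * y $ i)\<^sup>2"
        using pos by (simp add: \<rho>_def field_simps power2_eq_square)
      also have "\<dots> \<ge> 0" using pos by simp
      finally show ?thesis by simp
    qed
    hence "(\<Sum>i\<in>UNIV. u $ i * x $ i * y $ i + v $ i * (y $ i)\<^sup>2 - u $ i * x $ i - v $ i * y $ i)
        \<le> (\<Sum>i\<in>UNIV. \<rho> $ i * ((x $ i)\<^sup>2 / y $ i) - \<rho> $ i * (x $ i)\<^sup>2)"
      by (intro sum_mono)
    thus ?thesis
      by (simp add: z f_rho_eq f_uv_diff_diag f_uv_split[of Q c h u v] sum_subtractf)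
  qed
  ultimately show ?thesis using that by blast
qed

section \<open>Tangents to the perspective terms\<close>

text \<open>
  Each perspective term \<open>x\<^sup>2 / y\<close> is replaced by \<open>2 * t * x - t\<^sup>2 * y\<close>, its tangent plane along the ray
  \<open>x = t * y\<close>. This contributes only linear terms, so the result is again
  an \<open>f_uv\<close>, with zero \<open>u\<close> and \<open>v\<close> and shifted cost vectors, and the
  convexity criterion for \<open>f_uv\<close> applies to it.
\<close>

definition tangent_minorant ::
  "real ^ 'n ^ 'n \<Rightarrow> real ^ 'n \<Rightarrow> real ^ 'n \<Rightarrow> real ^ 'n \<Rightarrow> real ^ 'n
    \<Rightarrow> (real ^ 'n) \<times> (real ^ 'n) \<Rightarrow> real" where
  "tangent_minorant Q c h \<rho> t =
     f_uv (Q - diag \<rho>) (c + (\<chi> i. 2 * \<rho> $ i * t $ i)) (h - (\<chi> i. \<rho> $ i * (t $ i)\<^sup>2)) 0 0"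

lemma tangent_minorant_eq:
  "tangent_minorant Q c h \<rho> t (x, y) = f_uv (Q - diag \<rho>) c h 0 0 (x, y)
     + (\<Sum>i\<in>UNIV. \<rho> $ i * (2 * t $ i * x $ i - (t $ i)\<^sup>2 * y $ i))"
proof -
  have "(\<chi> i. 2 * \<rho> $ i * t $ i) \<bullet> x - (\<chi> i. \<rho> $ i * (t $ i)\<^sup>2) \<bullet> y
      = (\<Sum>i\<in>UNIV. \<rho> $ i * (2 * t $ i * x $ i - (t $ i)\<^sup>2 * y $ i))"
    by (simp add: inner_vec_def algebra_simps flip: sum_subtractf)
  thus ?thesis
    by (simp add: tangent_minorant_def f_uv_def inner_add_left inner_diff_left)
qed

lemma tangent_minorant_convex:
  assumes "psd (Q - diag \<rho>)"
  shows "convex_on UNIV (tangent_minorant Q c h \<rho> t)"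
  using assms by (simp add: tangent_minorant_def convex_f_uv_iff uv_form_def psd_def)

text \<open>
  With the coefficients generated by the slopes \<open>t\<close>, both \<open>f_uv\<close> and its quadratic part
  are a sum of weighted squares away from a simpler expression. The first equation bounds
  \<open>f_uv\<close> from below and the second makes it convex when \<open>\<rho> \<ge> 0\<close> and \<open>Q - diag \<rho>\<close> is psd.
\<close>

lemma f_uv_tangent:
  fixes \<rho> t :: "real ^ 'n"
  defines "u \<equiv> \<chi> i. - 2 * \<rho> $ i * t $ i" and "v \<equiv> \<chi> i. \<rho> $ i * (t $ i)\<^sup>2"
  shows "f_uv Q c h u v (x, y)
    = tangent_minorant Q c h \<rho> t (x, y) + (\<Sum>i\<in>UNIV. \<rho> $ i * (x $ i - t $ i * y $ i)\<^sup>2)"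
    and "uv_form Q u v x y
    = x \<bullet> ((Q - diag \<rho>) *v x) + (\<Sum>i\<in>UNIV. \<rho> $ i * (x $ i - t $ i * y $ i)\<^sup>2)"
proof -
  have *: "u $ i * x $ i * y $ i + v $ i * (y $ i)\<^sup>2 - u $ i * x $ i - v $ i * y $ i + \<rho> $ i * (x $ i)\<^sup>2
      = \<rho> $ i * (2 * t $ i * x $ i - (t $ i)\<^sup>2 * y $ i) + \<rho> $ i * (x $ i - t $ i * y $ i)\<^sup>2" for i
    unfolding u_def v_def by simp algebra
  have "(\<Sum>i\<in>UNIV. u $ i * x $ i * y $ i + v $ i * (y $ i)\<^sup>2 - u $ i * x $ i - v $ i * y $ i)
       + (\<Sum>i\<in>UNIV. \<rho> $ i * (x $ i)\<^sup>2)
      = (\<Sum>i\<in>UNIV. \<rho> $ i * (2 * t $ i * x $ i - (t $ i)\<^sup>2 * y $ i))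
       + (\<Sum>i\<in>UNIV. \<rho> $ i * (x $ i - t $ i * y $ i)\<^sup>2)"
    unfolding sum.distrib[symmetric] * ..
  thus "f_uv Q c h u v (x, y)
    = tangent_minorant Q c h \<rho> t (x, y) + (\<Sum>i\<in>UNIV. \<rho> $ i * (x $ i - t $ i * y $ i)\<^sup>2)"
    unfolding tangent_minorant_eq f_uv_diff_diag f_uv_split[of Q c h u v] by linarith
  have **: "u $ i * x $ i * y $ i + v $ i * (y $ i)\<^sup>2 + \<rho> $ i * (x $ i)\<^sup>2
      = \<rho> $ i * (x $ i - t $ i * y $ i)\<^sup>2" for i
    unfolding u_def v_def by simp algebra
  have "(\<Sum>i\<in>UNIV. u $ i * x $ i * y $ i + v $ i * (y $ i)\<^sup>2) + (\<Sum>i\<in>UNIV. \<rho> $ i * (x $ i)\<^sup>2)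
      = (\<Sum>i\<in>UNIV. \<rho> $ i * (x $ i - t $ i * y $ i)\<^sup>2)"
    unfolding sum.distrib[symmetric] ** ..
  thus "uv_form Q u v x y
    = x \<bullet> ((Q - diag \<rho>) *v x) + (\<Sum>i\<in>UNIV. \<rho> $ i * (x $ i - t $ i * y $ i)\<^sup>2)"
    by (simp add: uv_form_def matrix_vector_mult_diff_rdistrib inner_diff_right diag_quadratic_form)
qed

section \<open>Smoothing the perspective terms\<close>

definition smoothed_f_rho ::
  "real ^ 'n ^ 'n \<Rightarrow> real ^ 'n \<Rightarrow> real ^ 'n \<Rightarrow> real ^ 'n \<Rightarrow> real
    \<Rightarrow> (real ^ 'n) \<times> (real ^ 'n) \<Rightarrow> real" where
  "smoothed_f_rho Q c h \<rho> e = (\<lambda>(x, y). f_uv (Q - diag \<rho>) c h 0 0 (x, y)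
     + (\<Sum>i\<in>UNIV. \<rho> $ i * ((x $ i)\<^sup>2 / (y $ i + e))))"

text \<open>
  The exact remainder \<open>x\<^sup>2 / s = 2 * t * x - t\<^sup>2 * s + (x - t * s)\<^sup>2 / s\<close> of the tangent,
  taken at \<open>s = y + e\<close>; the shift \<open>e\<close> accounts for the constant term.
\<close>

lemma smoothed_f_rho_eq:
  assumes "0 < e" "\<And>i. 0 \<le> y $ i"
  shows "smoothed_f_rho Q c h \<rho> e (x, y) = tangent_minorant Q c h \<rho> t (x, y)
    - e * (\<Sum>i\<in>UNIV. \<rho> $ i * (t $ i)\<^sup>2)
    + (\<Sum>i\<in>UNIV. \<rho> $ i * ((x $ i - t $ i * (y $ i + e))\<^sup>2 / (y $ i + e)))"
proof -
  have "\<rho> $ i * ((x $ i)\<^sup>2 / (y $ i + e)) = \<rho> $ i * (2 * t $ i * x $ i - (t $ i)\<^sup>2 * y $ i)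
      - e * (\<rho> $ i * (t $ i)\<^sup>2) + \<rho> $ i * ((x $ i - t $ i * (y $ i + e))\<^sup>2 / (y $ i + e))" for i
  proof -
    define s where "s = y $ i + e"
    have "s \<noteq> 0" using assms(1) assms(2)[of i] by (simp add: s_def)
    hence "(x $ i)\<^sup>2 / s = 2 * t $ i * x $ i - (t $ i)\<^sup>2 * s + (x $ i - t $ i * s)\<^sup>2 / s"
      by (simp add: field_simps power2_eq_square)
    moreover have "(t $ i)\<^sup>2 * s = (t $ i)\<^sup>2 * y $ i + e * (t $ i)\<^sup>2" by (simp add: s_def algebra_simps)
    ultimately have "(x $ i)\<^sup>2 / s = 2 * t $ i * x $ i - (t $ i)\<^sup>2 * y $ i - e * (t $ i)\<^sup>2
        + (x $ i - t $ i * s)\<^sup>2 / s" by linarith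
    thus ?thesis unfolding s_def[symmetric] by (simp only:) (simp only: algebra_simps)
  qed
  thus ?thesis
    by (simp add: smoothed_f_rho_def tangent_minorant_eq sum.distrib sum_subtractf sum_distrib_left)
qed

text \<open>
  First-order optimality without derivatives. With slopes read off at the minimiser \<open>(p, q)\<close>, the tangent
  remainder vanishes there and is at most \<open>k\<^sup>2 * R\<close> after the fraction \<open>k\<close> of the
  segment towards any other point \<open>z\<close>. By convexity the tangent minorant grows at most linearly along the
  segment, so minimality of \<open>(p, q)\<close> gives \<open>L (p, q) \<le> L z + k * R\<close>, and \<open>k\<close> tends to \<open>0\<close>.
\<close>

lemma smoothed_min_tangent:
  fixes \<rho> :: "real ^ 'n" and S :: "((real ^ 'n) \<times> (real ^ 'n)) set"
  assumes \<rho>: "0 \<le> \<rho>" and psd: "psd (Q - diag \<rho>)" and e: "0 < e"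
    and S: "convex S" "\<And>x y i. (x, y) \<in> S \<Longrightarrow> 0 \<le> y $ i"
    and p: "(p, q) \<in> S"
    and min: "\<And>z. z \<in> S \<Longrightarrow> smoothed_f_rho Q c h \<rho> e (p, q) \<le> smoothed_f_rho Q c h \<rho> e z"
    and z: "z \<in> S"
  shows "smoothed_f_rho Q c h \<rho> e (p, q) \<le> tangent_minorant Q c h \<rho> (\<chi> i. p $ i / (q $ i + e)) z"
proof -
  define t where "t = (\<chi> i. p $ i / (q $ i + e))"
  define L where "L = tangent_minorant Q c h \<rho> t"
  define K where "K = e * (\<Sum>i\<in>UNIV. \<rho> $ i * (t $ i)\<^sup>2)"
  have \<rho>i: "0 \<le> \<rho> $ i" for i using \<rho> by (simp add: less_eq_vec_def)
  obtain x y where xy: "z = (x, y)" by fastforce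
  have q: "0 < q $ i + e" for i using S(2)[OF p, of i] e by simp
  have res0: "p $ i - t $ i * (q $ i + e) = 0" for i using q[of i] by (simp add: t_def)
  have Gp: "smoothed_f_rho Q c h \<rho> e (p, q) = L (p, q) - K"
    using smoothed_f_rho_eq[OF e S(2)[OF p], of Q c h \<rho> p t] by (simp add: res0 L_def K_def)
  define R where "R = (\<Sum>i\<in>UNIV. \<rho> $ i * ((x $ i - p $ i - t $ i * (y $ i - q $ i))\<^sup>2 / e))"
  have step: "L (p, q) \<le> L z + k * R" if k: "0 < k" "k \<le> 1" for k
  proof -
    define x' y' where "x' = (1 - k) *\<^sub>R p + k *\<^sub>R x" and "y' = (1 - k) *\<^sub>R q + k *\<^sub>R y"
    have comb: "(1 - k) *\<^sub>R (p, q) + k *\<^sub>R z = (x', y')" by (simp add: x'_def y'_def xy)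
    have in_S: "(x', y') \<in> S"
      unfolding comb[symmetric] using S(1) p z k by (intro convexD) auto
    have "\<rho> $ i * ((x' $ i - t $ i * (y' $ i + e))\<^sup>2 / (y' $ i + e))
        \<le> k\<^sup>2 * (\<rho> $ i * ((x $ i - p $ i - t $ i * (y $ i - q $ i))\<^sup>2 / e))" for i
    proof -
      have "x' $ i - t $ i * (y' $ i + e)
          = (p $ i - t $ i * (q $ i + e)) + k * (x $ i - p $ i - t $ i * (y $ i - q $ i))"
        by (simp add: x'_def y'_def algebra_simps)
      hence eq: "(x' $ i - t $ i * (y' $ i + e))\<^sup>2
          = k\<^sup>2 * (x $ i - p $ i - t $ i * (y $ i - q $ i))\<^sup>2"
        by (simp add: res0 power_mult_distrib)
      have "(x' $ i - t $ i * (y' $ i + e))\<^sup>2 / (y' $ i + e) \<le> (x' $ i - t $ i * (y' $ i + e))\<^sup>2 / e"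
        using S(2)[OF in_S, of i] e by (intro divide_left_mono) auto
      from mult_left_mono[OF this \<rho>i[of i]] show ?thesis by (simp add: eq mult_ac)
    qed
    hence "(\<Sum>i\<in>UNIV. \<rho> $ i * ((x' $ i - t $ i * (y' $ i + e))\<^sup>2 / (y' $ i + e))) \<le> k\<^sup>2 * R"
      unfolding R_def sum_distrib_left by (intro sum_mono)
    hence "smoothed_f_rho Q c h \<rho> e (x', y') \<le> L (x', y') - K + k\<^sup>2 * R"
      using smoothed_f_rho_eq[OF e S(2)[OF in_S], of Q c h \<rho> x' t] by (simp add: L_def K_def)
    moreover have "L (x', y') \<le> (1 - k) * L (p, q) + k * L z"
      using convex_onD[OF tangent_minorant_convex[OF psd, of c h t], of k "(p, q)" z] k
      unfolding comb by (simp add: L_def)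
    ultimately have "L (p, q) - K \<le> (1 - k) * L (p, q) + k * L z - K + k\<^sup>2 * R"
      using min[OF in_S] Gp by linarith
    hence "k * L (p, q) \<le> k * (L z + k * R)" by (simp add: algebra_simps power2_eq_square)
    thus ?thesis using k by simp
  qed
  have "0 \<le> R" unfolding R_def using e \<rho>i by (intro sum_nonneg) auto
  have "L (p, q) \<le> L z"
  proof (rule tendsto_lowerbound)
    show "((\<lambda>k. L z + k * R) \<longlongrightarrow> L z) (at_right 0)"
      by (rule tendsto_eq_intros | simp)+
    show "\<forall>\<^sub>F k in at_right 0. L (p, q) \<le> L z + k * R"
      using eventually_at_right_less[of 0] eventually_at_right_real[of 0 1]
      by (auto elim!: eventually_mono intro: step)
  qed simp
  moreover have "0 \<le> K" unfolding K_def using e \<rho>i by (intro mult_nonneg_nonneg sum_nonneg) auto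
  ultimately show ?thesis using Gp by (simp add: L_def t_def)
qed

text \<open>
  The smoothing error \<open>x\<^sup>2 / y - x\<^sup>2 / (y + e) = e * x\<^sup>2 / (y * (y + e))\<close> is at most
  \<open>e * T\<^sup>2\<close>, even near \<open>y = 0\<close>, because \<open>x\<^sup>2 \<le> T\<^sup>2 * y\<^sup>2\<close>.
\<close>

lemma smoothed_f_rho_ge:
  assumes \<rho>: "0 \<le> \<rho>" and e: "0 < e"
    and y: "\<And>i. 0 \<le> y $ i" and x: "\<And>i. \<bar>x $ i\<bar> \<le> T $ i * y $ i"
  shows "f_rho Q c h \<rho> (x, y) - e * (\<Sum>i\<in>UNIV. \<rho> $ i * (T $ i)\<^sup>2) \<le> smoothed_f_rho Q c h \<rho> e (x, y)"
proof -
  have "\<rho> $ i * ((x $ i)\<^sup>2 / y $ i) - e * (\<rho> $ i * (T $ i)\<^sup>2) \<le> \<rho> $ i * ((x $ i)\<^sup>2 / (y $ i + e))" for i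
  proof -
    have "(x $ i)\<^sup>2 / y $ i - e * (T $ i)\<^sup>2 \<le> (x $ i)\<^sup>2 / (y $ i + e)"
    proof (cases "y $ i = 0")
      case True
      have "- (e * (T $ i)\<^sup>2) \<le> 0" "0 \<le> (x $ i)\<^sup>2 / e" using e by simp_all
      hence "- (e * (T $ i)\<^sup>2) \<le> (x $ i)\<^sup>2 / e" by (rule order_trans)
      with True show ?thesis by simp
    next
      case False
      with y[of i] have pos: "0 < y $ i" by simp
      have "(x $ i)\<^sup>2 \<le> (T $ i)\<^sup>2 * (y $ i)\<^sup>2"
        using power_mono[OF x[of i], of 2] by (simp add: power_mult_distrib)
      also have "\<dots> \<le> (T $ i)\<^sup>2 * (y $ i * (y $ i + e))"
        using pos e by (intro mult_left_mono) (auto simp: power2_eq_square)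
      finally have "e * (x $ i)\<^sup>2 / (y $ i * (y $ i + e)) \<le> e * (T $ i)\<^sup>2"
        using pos e by (simp add: divide_le_eq mult_ac)
      moreover have "(x $ i)\<^sup>2 / y $ i - (x $ i)\<^sup>2 / (y $ i + e) = e * (x $ i)\<^sup>2 / (y $ i * (y $ i + e))"
        using pos e by (simp add: field_simps)
      ultimately show ?thesis by linarith
    qed
    moreover have "0 \<le> \<rho> $ i" using \<rho> by (simp add: less_eq_vec_def)
    ultimately show ?thesis using mult_left_mono by (fastforce simp: algebra_simps)
  qed
  hence "(\<Sum>i\<in>UNIV. \<rho> $ i * ((x $ i)\<^sup>2 / y $ i) - e * (\<rho> $ i * (T $ i)\<^sup>2))
      \<le> (\<Sum>i\<in>UNIV. \<rho> $ i * ((x $ i)\<^sup>2 / (y $ i + e)))" by (intro sum_mono)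
  thus ?thesis by (simp add: f_rho_eq smoothed_f_rho_def sum_subtractf sum_distrib_left)
qed

lemma continuous_on_smoothed_f_rho:
  assumes "0 < e" "\<And>x y i. (x, y) \<in> S \<Longrightarrow> 0 \<le> y $ i"
  shows "continuous_on S (smoothed_f_rho Q c h \<rho> e)"
proof -
  have "snd z $ i + e \<noteq> 0" if "z \<in> S" for z i
    using assms(1) assms(2)[of "fst z" "snd z" i] that by simp
  thus ?thesis
    unfolding smoothed_f_rho_def f_uv_def case_prod_unfold
    by (intro continuous_intros continuous_on_matrix_vector_mult) auto
qed

section \<open>Perspective relaxations are matched by convex quadratic relaxations\<close>

text \<open>
  The minimax step: a lower bound for \<open>f_rho\<close>, which is at each point the supremum of the tangent
  minorants, is already a lower bound for a single one of them. For every \<open>e > 0\<close> the smoothed minimiser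
  provides slopes in a fixed box that achieve the bound up to \<open>e * C\<close>, and the minorant is
  continuous in the slopes.
\<close>

lemma perspective_dual:
  fixes \<rho> T :: "real ^ 'n" and S :: "((real ^ 'n) \<times> (real ^ 'n)) set"
  assumes \<rho>: "0 \<le> \<rho>" and psd: "psd (Q - diag \<rho>)"
    and S: "convex S" "compact S" "S \<noteq> {}" "\<And>x y i. (x, y) \<in> S \<Longrightarrow> 0 \<le> y $ i"
    and T: "\<And>x y i. (x, y) \<in> S \<Longrightarrow> \<bar>x $ i\<bar> \<le> T $ i * y $ i" "\<And>i. 0 \<le> T $ i"
    and m: "\<And>z. z \<in> S \<Longrightarrow> m \<le> f_rho Q c h \<rho> z"
  obtains t where "\<And>z. z \<in> S \<Longrightarrow> m \<le> tangent_minorant Q c h \<rho> t z"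
proof -
  define C where "C = (\<Sum>i\<in>UNIV. \<rho> $ i * (T $ i)\<^sup>2)"
  have "\<exists>t\<in>cbox (- T) T. \<forall>z\<in>S. m - e * C \<le> tangent_minorant Q c h \<rho> t z" if e: "0 < e" for e
  proof -
    obtain p q where p: "(p, q) \<in> S"
      and min: "\<And>z. z \<in> S \<Longrightarrow> smoothed_f_rho Q c h \<rho> e (p, q) \<le> smoothed_f_rho Q c h \<rho> e z"
    proof -
      have "continuous_on S (smoothed_f_rho Q c h \<rho> e)"
        using e S(4) by (rule continuous_on_smoothed_f_rho)
      from continuous_attains_inf[OF S(2,3) this] show ?thesis
        using that by (metis surj_pair)
    qed
    define t where "t = (\<chi> i. p $ i / (q $ i + e))"
    have "\<bar>t $ i\<bar> \<le> T $ i" for i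
    proof -
      have "\<bar>p $ i\<bar> \<le> T $ i * (q $ i + e)"
        using T(1)[OF p, of i] T(2)[of i] e by (auto simp: algebra_simps intro: order_trans)
      thus ?thesis using S(4)[OF p, of i] e by (simp add: t_def abs_divide divide_le_eq)
    qed
    hence "t \<in> cbox (- T) T" by (simp add: mem_box_cart abs_le_iff minus_le_iff)
    moreover have "m - e * C \<le> tangent_minorant Q c h \<rho> t z" if "z \<in> S" for z
    proof -
      have "smoothed_f_rho Q c h \<rho> e (p, q) \<le> tangent_minorant Q c h \<rho> t z"
        unfolding t_def using \<rho> psd e S(1,4) p min that by (rule smoothed_min_tangent)
      thus ?thesis using smoothed_f_rho_ge[OF \<rho> e S(4)[OF p] T(1)[OF p], of Q c h] m[OF p]
        unfolding C_def by linarith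
    qed
    ultimately show ?thesis by blast
  qed
  hence "\<forall>k. \<exists>t. t \<in> cbox (- T) T \<and> (\<forall>z\<in>S. m - inverse (real (Suc k)) * C \<le> tangent_minorant Q c h \<rho> t z)"
    by (meson inverse_positive_iff_positive of_nat_0_less_iff zero_less_Suc)
  then obtain ts where ts: "\<And>k. ts k \<in> cbox (- T) T"
    "\<And>k z. z \<in> S \<Longrightarrow> m - inverse (real (Suc k)) * C \<le> tangent_minorant Q c h \<rho> (ts k) z"
    by metis
  obtain t r where r: "strict_mono r" and lim: "(ts \<circ> r) \<longlonglongrightarrow> t"
    using compact_cbox[of "- T" T] ts(1) unfolding compact_def by blast
  have "m \<le> tangent_minorant Q c h \<rho> t z" if "z \<in> S" for z
  proof (rule LIMSEQ_le)
    obtain x y where z: "z = (x, y)" by fastforce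
    show "(\<lambda>k. tangent_minorant Q c h \<rho> ((ts \<circ> r) k) z) \<longlonglongrightarrow> tangent_minorant Q c h \<rho> t z"
      unfolding z tangent_minorant_eq by (intro tendsto_intros lim)
    have "(\<lambda>k. m - inverse (real (Suc k)) * C) \<longlonglongrightarrow> m - 0 * C"
      by (intro tendsto_intros LIMSEQ_inverse_real_of_nat)
    from LIMSEQ_subseq_LIMSEQ[OF this r]
    show "(\<lambda>k. m - inverse (real (Suc (r k))) * C) \<longlonglongrightarrow> m" by (simp add: o_def)
    show "\<exists>N. \<forall>k\<ge>N. m - inverse (real (Suc (r k))) * C \<le> tangent_minorant Q c h \<rho> ((ts \<circ> r) k) z"
      using ts(2)[OF that] by simp
  qed
  thus ?thesis using that by blast
qed

text \<open>
  Stated for an arbitrary real lower bound \<open>m\<close> rather than for the optimal value, so that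
  extended-real values need no case distinction.
\<close>

lemma f_rho_lower_bound_by_convex_f_uv:
  assumes \<rho>: "0 \<le> \<rho>" "psd (Q - diag \<rho>)" and ne: "relaxed_set A B d a b \<noteq> {}"
    and m: "\<And>z. z \<in> relaxed_set A B d a b \<Longrightarrow> m \<le> f_rho Q c h \<rho> z"
  obtains u v where "convex_on UNIV (f_uv Q c h u v)"
    "\<And>z. z \<in> relaxed_set A B d a b \<Longrightarrow> m \<le> f_uv Q c h u v z"
proof -
  define T :: "real ^ 'a" where "T = (\<chi> i. max \<bar>a $ i\<bar> \<bar>b $ i\<bar>)"
  obtain t where t: "\<And>z. z \<in> relaxed_set A B d a b \<Longrightarrow> m \<le> tangent_minorant Q c h \<rho> t z"
  proof (rule perspective_dual[OF \<rho> convex_relaxed_set compact_relaxed_set ne, of T m c h])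
    show "\<bar>x $ i\<bar> \<le> T $ i * y $ i" if "(x, y) \<in> relaxed_set A B d a b" for x y i
      using relaxed_set_abs_le[OF that, of i] by (simp add: T_def)
  qed (auto simp: T_def relaxed_set_def intro: m)
  have sq: "0 \<le> (\<Sum>i\<in>UNIV. \<rho> $ i * (x $ i - t $ i * y $ i)\<^sup>2)" for x y
    using \<rho>(1) by (intro sum_nonneg) (simp add: less_eq_vec_def)
  define u v where "u = (\<chi> i. - 2 * \<rho> $ i * t $ i)" and "v = (\<chi> i. \<rho> $ i * (t $ i)\<^sup>2)"
  show ?thesis
  proof (rule that)
    show "convex_on UNIV (f_uv Q c h u v)"
      unfolding convex_f_uv_iff u_def v_def f_uv_tangent(2) using \<rho>(2) sq by (simp add: psd_def)
    fix z assume z: "z \<in> relaxed_set A B d a b"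
    obtain x y where xy: "z = (x, y)" by fastforce
    show "m \<le> f_uv Q c h u v z"
      using t[OF z] sq[of x y] unfolding xy u_def v_def f_uv_tangent(1) by linarith
  qed
qed

section \<open>Equality of the two dual bounds\<close>

theorem theorem6:
  fixes Q :: "real ^ 'n ^ 'n"
    and c h a b u v \<rho> :: "real ^ 'n"
    and A B :: "real ^ 'n ^ 'm"
    and d :: "real ^ 'm"
  assumes "psd Q"
    and "\<And>i. a $ i < b $ i"
    and "feasible_set A B d a b \<noteq> {}"
    and "optimal_MAXuv Q c h A B d a b u v"
    and "optimal_MAXrho Q c h A B d a b \<rho>"
  shows "v_P Q c h A B d a b u v = v_PR Q c h A B d a b \<rho>"
proof (rule antisym)
  let ?S = "relaxed_set A B d a b"
  have uv: "convex_on UNIV (f_uv Q c h u v)"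
    "\<And>u' v'. convex_on UNIV (f_uv Q c h u' v') \<Longrightarrow> v_P Q c h A B d a b u' v' \<le> v_P Q c h A B d a b u v"
    using assms(4) by (auto simp: optimal_MAXuv_def is_arg_max_def not_less)
  have \<rho>: "0 \<le> \<rho>" "psd (Q - diag \<rho>)"
    "\<And>\<rho>'. 0 \<le> \<rho>' \<Longrightarrow> psd (Q - diag \<rho>') \<Longrightarrow> v_PR Q c h A B d a b \<rho>' \<le> v_PR Q c h A B d a b \<rho>"
    using assms(5) by (auto simp: optimal_MAXrho_def is_arg_max_def not_less)
  obtain \<rho>' where \<rho>': "0 \<le> \<rho>'" "psd (Q - diag \<rho>')"
    "\<And>z. z \<in> ?S \<Longrightarrow> f_uv Q c h u v z \<le> f_rho Q c h \<rho>' z"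
    using convex_f_uv_le_f_rho[OF assms(1) uv(1)] by metis
  have "v_P Q c h A B d a b u v \<le> v_PR Q c h A B d a b \<rho>'"
    unfolding v_P_def v_PR_def opt_value_def using \<rho>'(3) by (intro INF_mono) auto
  also have "\<dots> \<le> v_PR Q c h A B d a b \<rho>" using \<rho>'(1,2) by (rule \<rho>(3))
  finally show "v_P Q c h A B d a b u v \<le> v_PR Q c h A B d a b \<rho>" .

  have "feasible_set A B d a b \<subseteq> ?S"
    unfolding feasible_set_def relaxed_set_def
    by clarify (metis atLeastAtMost_iff insertE order_refl singletonD zero_le_one)
  with assms(3) have ne: "?S \<noteq> {}" by blast
  show "v_PR Q c h A B d a b \<rho> \<le> v_P Q c h A B d a b u v"
  proof (rule ccontr)
    assume "\<not> ?thesis"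
    then obtain m where m: "v_P Q c h A B d a b u v < ereal m" "ereal m < v_PR Q c h A B d a b \<rho>"
      using ereal_dense2 not_less by blast
    hence "m \<le> f_rho Q c h \<rho> z" if "z \<in> ?S" for z
      using that by (simp add: v_PR_def opt_value_def) (metis INF_lower ereal_less_eq(3) less_imp_le order_trans)
    then obtain u' v' where conv: "convex_on UNIV (f_uv Q c h u' v')"
      and ge: "\<And>z. z \<in> ?S \<Longrightarrow> m \<le> f_uv Q c h u' v' z"
      using f_rho_lower_bound_by_convex_f_uv[OF \<rho>(1,2) ne] by metis
    have "ereal m \<le> v_P Q c h A B d a b u' v'"
      using ge by (auto simp: v_P_def opt_value_def le_INF_iff)
    also have "\<dots> \<le> v_P Q c h A B d a b u v" using conv by (rule uv(2))
    finally show False using m(1) by simp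
  qed
qed

end
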